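(* For every real $u>0$, $$\log\Gamma(u)=\sum_{n=0}^{\infty}\frac{1}{n+1}\sum_{k=0}^{n}\binom{n}{k}(-1)^k(u+k)\log(u+k)+\frac12-u+\frac12\log(2\pi).$$
   Context: $\Gamma$ is the Euler gamma function and $\log$ is the real natural logarithm. The outer series is summed in the order written (sum over $n$ of the finite inner sums). *)

theory Defs
  imports "HOL-Analysis.Analysis"
begin

end

theory Submission
  imports Defs "HOL-Real_Asymp.Real_Asymp"
begin

text \<open>
  Write \<open>f x = x * ln x\<close> and let \<open>g n\<close> be its \<open>n\<close>-th iterated difference with respect to
  \<open>f \<mapsto> f x - f (x + 1)\<close>, which is the inner sum. The series is thus \<open>S = (\<Sum>n. g n / (n + 1))\<close>.
  The second derivative of \<open>g n\<close> is the \<open>n\<close>-th iterated difference of \<open>1 / x\<close>, namely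
  \<open>h n x = n! / (x (x + 1) \<dots> (x + n)) > 0\<close>. So every \<open>g n\<close> is convex.

  All estimates come from one principle: a convex function that tends to \<open>0\<close> at infinity is
  nonnegative (\<open>convex_on_tendsto_0_nonneg\<close>). Inequalities between second derivatives of functions
  that vanish at infinity therefore pass to the functions themselves. Together with the telescoping
  identity \<open>h (n - 1) x - h n x = x * h n x / n\<close> this gives two facts:

    \<^item> for \<open>n \<ge> 2\<close> the terms are nonnegative, and they sum to at most \<open>1 / (2 x)\<close>
      (\<open>sum_bdiff_xlnx_le\<close>); hence the series converges, and it differs from its first two terms
      by a quantity that vanishes as \<open>x\<close> tends to infinity;

    \<^item> \<open>(\<Sum>n. g (n + 1) x / (n + 1)) = - ln x - 1\<close> (\<open>sums_bdiff_xlnx_Suc\<close>), which says that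
      \<open>S (x + 1) - S x = ln x + 1\<close>.

  Hence \<open>S x - x\<close> is convex and satisfies the functional equation of \<open>ln \<circ> Gamma\<close>, and by the
  Bohr-Mollerup theorem it differs from \<open>ln \<circ> Gamma\<close> by a constant. The constant is found by
  letting \<open>x\<close> tend to infinity in Legendre's duplication formula.
\<close>

section \<open>Iterated differences\<close>

text \<open>
  The \<open>n\<close>-th iterate of the difference operator \<open>f x - f (x + 1)\<close>. The sign is the opposite of
  that of the forward difference, so that no factor \<open>(-1) ^ n\<close> occurs.
\<close>

definition bdiff :: "nat \<Rightarrow> (real \<Rightarrow> real) \<Rightarrow> real \<Rightarrow> real" where
  "bdiff n f x = (\<Sum>k=0..n. real (n choose k) * (-1) ^ k * f (x + real k))"

lemma bdiff_0 [simp]: "bdiff 0 f x = f x"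
  by (simp add: bdiff_def)

lemma bdiff_Suc: "bdiff (Suc n) f x = bdiff n f x - bdiff n f (x + 1)"
proof -
  have eq: "(\<Sum>k\<le>n. real (n choose k) * (-1) ^ k * f (x + real k)) =
            f x - (\<Sum>k\<le>n. real (n choose Suc k) * (-1) ^ k * f (x + 1 + real k))"
  proof -
    have "(\<Sum>k\<le>n. real (n choose k) * (-1) ^ k * f (x + real k)) =
          (\<Sum>k\<le>Suc n. real (n choose k) * (-1) ^ k * f (x + real k))"
      by (simp add: binomial_eq_0)
    also have "\<dots> = f x - (\<Sum>k\<le>n. real (n choose Suc k) * (-1) ^ k * f (x + 1 + real k))"
      by (subst sum.atMost_Suc_shift) (simp add: add_ac sum_negf)
    finally show ?thesis .
  qed
  have "bdiff (Suc n) f x = f x -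
          (\<Sum>k\<le>n. (real (n choose k) + real (n choose Suc k)) * (-1) ^ k * f (x + 1 + real k))"
    unfolding bdiff_def atLeast0AtMost
    by (subst sum.atMost_Suc_shift) (simp add: add_ac sum_negf)
  also have "\<dots> = bdiff n f x - bdiff n f (x + 1)"
    unfolding bdiff_def atLeast0AtMost eq by (simp add: ring_distribs sum.distrib)
  finally show ?thesis .
qed

lemma has_real_derivative_bdiff:
  assumes "\<And>y. y \<ge> x \<Longrightarrow> (f has_real_derivative f' y) (at y)"
  shows   "(bdiff n f has_real_derivative bdiff n f' x) (at x)"
proof -
  have "((\<lambda>x. f (x + real k)) has_real_derivative f' (x + real k)) (at x)" for k
    using assms[of "x + real k"] by (simp add: DERIV_shift)
  thus ?thesis
    unfolding bdiff_def [abs_def] by (intro DERIV_sum DERIV_cmult)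
qed

lemma tendsto_bdiff_Suc:
  assumes "(bdiff n f \<longlongrightarrow> c) at_top"
  shows   "(bdiff (Suc n) f \<longlongrightarrow> 0) at_top"
proof -
  have "filterlim (\<lambda>x::real. x + 1) at_top at_top"
    by real_asymp
  from filterlim_compose[OF assms this]
  have "((\<lambda>x. bdiff n f x - bdiff n f (x + 1)) \<longlongrightarrow> c - c) at_top"
    by (intro tendsto_diff assms)
  thus ?thesis by (simp add: bdiff_Suc [abs_def])
qed

text \<open>The second derivatives of the iterated differences of \<open>x * ln x\<close>.\<close>

definition recip_diff :: "nat \<Rightarrow> real \<Rightarrow> real" where
  "recip_diff n x = fact n / pochhammer x (Suc n)"

lemma recip_diff_0: "recip_diff 0 x = 1 / x"
  by (simp add: recip_diff_def)

lemma recip_diff_nonneg: "x > 0 \<Longrightarrow> recip_diff n x \<ge> 0"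
  by (simp add: recip_diff_def pochhammer_pos less_imp_le)

lemma bdiff_inverse:
  assumes "x > 0"
  shows   "bdiff n (\<lambda>x. 1 / x) x = recip_diff n x"
  using assms
proof (induction n arbitrary: x)
  case (Suc n)
  define p where "p = pochhammer (x + 1) n"
  have p: "p > 0"
    unfolding p_def using Suc.prems by (intro pochhammer_pos) auto
  have 1: "pochhammer x (Suc n) = x * p"
    by (simp add: p_def pochhammer_rec)
  have 2: "pochhammer (x + 1) (Suc n) = p * (x + 1 + real n)"
    by (simp add: p_def pochhammer_rec' mult_ac)
  have 3: "pochhammer x (Suc (Suc n)) = x * (p * (x + 1 + real n))"
    by (subst pochhammer_rec, subst 2) simp
  have "bdiff (Suc n) (\<lambda>x. 1 / x) x = recip_diff n x - recip_diff n (x + 1)"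
    using Suc.prems by (simp add: bdiff_Suc Suc.IH)
  also have "\<dots> = fact n / (x * p) - fact n / (p * (x + 1 + real n))"
    by (simp only: recip_diff_def 1 2)
  also have "\<dots> = fact (Suc n) / (x * (p * (x + 1 + real n)))"
  proof -
    have "fact n / (x * p) - fact n / (p * q) = fact n * (q - x) / (x * (p * q))" if "q > 0" for q :: real
      using that p Suc.prems by (simp add: field_simps)
    from this[of "x + 1 + real n"] show ?thesis
      using Suc.prems by (simp add: algebra_simps)
  qed
  also have "\<dots> = recip_diff (Suc n) x"
    by (simp only: recip_diff_def 3)
  finally show ?case .
qed (simp add: recip_diff_0)

lemma recip_diff_Suc:
  assumes "x > 0"
  shows   "recip_diff (Suc n) x / real (n + 1) = (recip_diff n x - recip_diff (Suc n) x) / x"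
proof -
  define p where "p = pochhammer x (Suc n)"
  have p: "p > 0"
    unfolding p_def using assms by (intro pochhammer_pos)
  have "pochhammer x (Suc (Suc n)) = (x + 1 + real n) * p"
    by (simp add: p_def pochhammer_rec'[of x "Suc n"] add_ac)
  thus ?thesis
    using assms p by (simp add: recip_diff_def p_def [symmetric] divide_simps) (simp add: algebra_simps)
qed

lemma sum_recip_diff:
  assumes "x > 0"
  shows   "(\<Sum>n<N. recip_diff (Suc n) x / real (n + 1)) = (1 / x - recip_diff N x) / x"
proof (induction N)
  case (Suc N)
  thus ?case
    by (simp only: sum.lessThan_Suc recip_diff_Suc[OF assms]) (simp add: diff_divide_distrib)
qed (simp add: recip_diff_0)

lemma sum_recip_diff_le:
  assumes "x > 0"
  shows   "(\<Sum>n<N. recip_diff (n + 2) x / real (n + 3)) \<le> 1 / x ^ 3"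
proof -
  have "(\<Sum>n<N. recip_diff (n + 2) x / real (n + 3)) \<le>
        (\<Sum>n<N. recip_diff (Suc (Suc n)) x / real (Suc n + 1))"
    using assms by (intro sum_mono) (auto intro!: divide_left_mono recip_diff_nonneg)
  also have "\<dots> = (\<Sum>n<Suc N. recip_diff (Suc n) x / real (n + 1)) - recip_diff 1 x"
    by (subst sum.lessThan_Suc_shift) simp
  also have "\<dots> = 1 / x ^ 2 - recip_diff (Suc N) x / x - recip_diff 1 x"
    by (subst sum_recip_diff[OF assms]) (simp add: diff_divide_distrib power2_eq_square)
  also have "\<dots> \<le> 1 / x ^ 2 - recip_diff 1 x"
    using assms recip_diff_nonneg[of x "Suc N"] by simp
  also have "\<dots> \<le> 1 / x ^ 3"
  proof -
    have "1 / x ^ 3 - (1 / x ^ 2 - recip_diff 1 x) = 1 / (x ^ 3 * (x + 1))"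
      using assms by (simp add: recip_diff_def pochhammer_rec divide_simps)
                     (simp add: algebra_simps eval_nat_numeral)
    also have "\<dots> \<ge> 0" using assms by simp
    finally show ?thesis by simp
  qed
  finally show ?thesis .
qed

lemma pochhammer_mono:
  fixes x y :: real
  assumes "0 < x" "x \<le> y"
  shows   "pochhammer x n \<le> pochhammer y n"
  unfolding pochhammer_prod using assms by (intro prod_mono) auto

text \<open>
  The exponent \<open>2\<close> matters: divided by \<open>x\<close>, the right-hand side is still the second derivative
  of a function vanishing at infinity.
\<close>

lemma recip_diff_le:
  assumes "0 < u" "u \<le> x" "n > 0"
  shows   "recip_diff n x \<le> u * (u + 1) * recip_diff n u / x ^ 2"
proof -
  obtain m where n: "n = Suc m"
    using assms(3) by (cases n) auto
  have *: "recip_diff n z = fact n / (z * ((z + 1) * pochhammer (z + 2) m))" for z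
    by (simp add: recip_diff_def n pochhammer_rec add_ac)
  have pos: "pochhammer (u + 2) m > 0"
    using assms by (intro pochhammer_pos) auto
  have le: "pochhammer (u + 2) m \<le> pochhammer (x + 2) m"
    using assms by (intro pochhammer_mono) auto
  have "x ^ 2 * pochhammer (u + 2) m \<le> (x * (x + 1)) * pochhammer (x + 2) m"
    using assms le pos by (intro mult_mono) (auto simp: power2_eq_square)
  hence "fact n / ((x * (x + 1)) * pochhammer (x + 2) m) \<le> fact n / (x ^ 2 * pochhammer (u + 2) m)"
    using assms pos le by (intro divide_left_mono mult_pos_pos) auto
  also have "\<dots> = u * (u + 1) * recip_diff n u / x ^ 2"
    using assms pos unfolding * by (simp add: divide_simps)
  finally show ?thesis
    unfolding *[of x] by (simp add: mult_ac)
qed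

lemma recip_diff_tendsto_0:
  assumes "u > 0"
  shows   "(\<lambda>n. recip_diff n u) \<longlonglongrightarrow> 0"
proof -
  have "(\<lambda>n. Gamma_series u n * real n powr (-u)) \<longlonglongrightarrow> Gamma u * 0"
  proof (intro tendsto_mult Gamma_series_LIMSEQ)
    show "(\<lambda>n. real n powr (-u)) \<longlonglongrightarrow> 0"
      using assms by real_asymp
  qed
  moreover have "eventually (\<lambda>n. Gamma_series u n * real n powr (-u) = recip_diff n u) sequentially"
    using eventually_gt_at_top[of 0]
    by eventually_elim
       (simp add: Gamma_series_def recip_diff_def powr_def exp_minus field_simps)
  ultimately show ?thesis
    using tendsto_cong by force
qed

section \<open>Convex functions vanishing at infinity\<close>

lemma convex_on_tendsto_0_nonneg:
  fixes f :: "real \<Rightarrow> real"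
  assumes "convex_on {x..} f" "(f \<longlongrightarrow> 0) at_top"
  shows   "f x \<ge> 0"
proof -
  have "filterlim (\<lambda>y::real. 2 * y - x) at_top at_top"
    by real_asymp
  from filterlim_compose[OF assms(2) this]
  have "((\<lambda>y. f x / 2 + f (2 * y - x) / 2) \<longlongrightarrow> f x / 2 + 0 / 2) at_top"
    by (intro tendsto_intros) simp_all
  moreover have "eventually (\<lambda>y. f y \<le> f x / 2 + f (2 * y - x) / 2) at_top"
    using eventually_ge_at_top[of x]
  proof eventually_elim
    \<comment> \<open>\<open>y\<close> is the midpoint of \<open>x\<close> and \<open>2 * y - x\<close>.\<close>
    case (elim y)
    have "f ((1 - 1/2) *\<^sub>R x + (1/2) *\<^sub>R (2 * y - x)) \<le> (1 - 1/2) * f x + (1/2) * f (2 * y - x)"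
      using elim by (intro convex_onD[OF assms(1)]) auto
    thus ?case by (simp add: algebra_simps)
  qed
  ultimately have "0 \<le> f x / 2 + 0 / 2"
    using tendsto_le[OF _ _ assms(2)] by force
  thus ?thesis by simp
qed

lemma second_deriv_nonneg_tendsto_0_nonneg:
  fixes f :: "real \<Rightarrow> real"
  assumes "\<And>y. y \<ge> x \<Longrightarrow> (f has_real_derivative f' y) (at y)"
  assumes "\<And>y. y \<ge> x \<Longrightarrow> (f' has_real_derivative f'' y) (at y)"
  assumes "\<And>y. y \<ge> x \<Longrightarrow> f'' y \<ge> 0"
  assumes "(f \<longlongrightarrow> 0) at_top"
  shows   "f x \<ge> 0"
proof (rule convex_on_tendsto_0_nonneg[where f = f])
  show "convex_on {x..} f"
    by (rule f''_ge0_imp_convex[where f' = f' and f'' = f'']) (use assms in auto)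
qed fact

lemma convex_on_LIMSEQ:
  fixes f :: "nat \<Rightarrow> real \<Rightarrow> real"
  assumes "\<And>n. convex_on A (f n)" "\<And>x. x \<in> A \<Longrightarrow> (\<lambda>n. f n x) \<longlonglongrightarrow> F x"
  shows   "convex_on A F"
proof (rule convex_onI)
  show cA: "convex A"
    using assms(1)[of 0] by (rule convex_on_imp_convex)
  fix t x y :: real
  assume t: "0 < t" "t < 1" and xy: "x \<in> A" "y \<in> A"
  have mem: "(1 - t) *\<^sub>R x + t *\<^sub>R y \<in> A"
    using cA t xy by (simp add: convex_alt)
  show "F ((1 - t) *\<^sub>R x + t *\<^sub>R y) \<le> (1 - t) * F x + t * F y"
  proof (rule LIMSEQ_le)
    show "(\<lambda>n. f n ((1 - t) *\<^sub>R x + t *\<^sub>R y)) \<longlonglongrightarrow> F ((1 - t) *\<^sub>R x + t *\<^sub>R y)"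
      by (intro assms(2) mem)
    show "(\<lambda>n. (1 - t) * f n x + t * f n y) \<longlonglongrightarrow> (1 - t) * F x + t * F y"
      by (intro tendsto_intros assms(2) xy)
    show "\<exists>N. \<forall>n\<ge>N. f n ((1 - t) *\<^sub>R x + t *\<^sub>R y) \<le> (1 - t) * f n x + t * f n y"
      using convex_onD[OF assms(1)] t xy by auto
  qed
qed

section \<open>Differences of \<open>x * ln x\<close>\<close>

text \<open>The function whose iterated differences are the inner sums.\<close>

definition xlnx :: "real \<Rightarrow> real" where
  "xlnx x = x * ln x"

lemma has_real_derivative_bdiff_xlnx:
  assumes "x > 0"
  shows   "(bdiff n xlnx has_real_derivative bdiff n (\<lambda>x. ln x + 1) x) (at x)"
  using assms unfolding xlnx_def
  by (intro has_real_derivative_bdiff) (auto intro!: derivative_eq_intros)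

lemma has_real_derivative2_bdiff_xlnx:
  assumes "x > 0"
  shows   "(bdiff n (\<lambda>x. ln x + 1) has_real_derivative recip_diff n x) (at x)"
  unfolding bdiff_inverse[OF assms, symmetric]
  by (intro has_real_derivative_bdiff)
     (use assms in \<open>auto intro!: derivative_eq_intros simp: field_simps\<close>)

lemma convex_on_bdiff_xlnx: "convex_on {0<..} (bdiff n xlnx)"
  by (rule f''_ge0_imp_convex[where f' = "bdiff n (\<lambda>x. ln x + 1)" and f'' = "recip_diff n"])
     (auto intro: has_real_derivative_bdiff_xlnx has_real_derivative2_bdiff_xlnx recip_diff_nonneg)

lemma bdiff_xlnx_1: "bdiff 1 xlnx x = x * ln x - (x + 1) * ln (x + 1)"
  by (simp add: bdiff_Suc xlnx_def)

lemma tendsto_bdiff_xlnx: "(bdiff (n + 2) xlnx \<longlongrightarrow> 0) at_top"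
proof (induction n)
  case 0
  have "bdiff 2 xlnx = (\<lambda>x. x * ln x - 2 * ((x + 1) * ln (x + 1)) + (x + 2) * ln (x + 2))"
    by (simp add: fun_eq_iff numeral_2_eq_2 bdiff_Suc xlnx_def add_ac)
  moreover have "((\<lambda>x::real. x * ln x - 2 * ((x + 1) * ln (x + 1)) + (x + 2) * ln (x + 2)) \<longlongrightarrow> 0) at_top"
    by real_asymp
  ultimately show ?case by (simp only: add_0)
next
  case (Suc n)
  from tendsto_bdiff_Suc[OF this] show ?case by simp
qed

lemma bdiff_xlnx_nonneg:
  assumes "x > 0"
  shows   "bdiff (n + 2) xlnx x \<ge> 0"
proof (rule convex_on_tendsto_0_nonneg[where f = "bdiff (n + 2) xlnx"])
  show "convex_on {x..} (bdiff (n + 2) xlnx)"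
    by (rule convex_on_subset[OF convex_on_bdiff_xlnx]) (use assms in auto)
qed (rule tendsto_bdiff_xlnx)

lemma has_real_derivative_recip: "y \<noteq> 0 \<Longrightarrow> ((\<lambda>x. K / (2 * x)) has_real_derivative -K / (2 * y ^ 2)) (at (y::real))"
  by (auto intro!: derivative_eq_intros simp: field_simps power2_eq_square)

lemma has_real_derivative2_recip: "y \<noteq> 0 \<Longrightarrow> ((\<lambda>x. -K / (2 * x ^ 2)) has_real_derivative K / y ^ 3) (at (y::real))"
  by (auto intro!: derivative_eq_intros simp: field_simps power2_eq_square power3_eq_cube)

text \<open>
  The function \<open>1 / (2 * x)\<close> has second derivative \<open>1 / x ^ 3\<close>, which by \<open>sum_recip_diff_le\<close>
  dominates the second derivative of the sum.
\<close>

lemma sum_bdiff_xlnx_le: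
  assumes "x > 0"
  shows   "(\<Sum>n<N. bdiff (n + 2) xlnx x / real (n + 3)) \<le> 1 / (2 * x)"
proof -
  have "0 \<le> 1 / (2 * x) - (\<Sum>n<N. bdiff (n + 2) xlnx x / real (n + 3))"
  proof (rule second_deriv_nonneg_tendsto_0_nonneg[where
        f = "\<lambda>x. 1 / (2 * x) - (\<Sum>n<N. bdiff (n + 2) xlnx x / real (n + 3))"])
    fix y assume "y \<ge> x"
    with assms have y: "y > 0" by simp
    show "((\<lambda>x. 1 / (2 * x) - (\<Sum>n<N. bdiff (n + 2) xlnx x / real (n + 3))) has_real_derivative
            (-1 / (2 * y ^ 2) - (\<Sum>n<N. bdiff (n + 2) (\<lambda>x. ln x + 1) y / real (n + 3)))) (at y)"
      by (intro DERIV_diff has_real_derivative_recip DERIV_sum DERIV_cdivide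
            has_real_derivative_bdiff_xlnx) (use y in auto)
    show "((\<lambda>y. -1 / (2 * y ^ 2) - (\<Sum>n<N. bdiff (n + 2) (\<lambda>x. ln x + 1) y / real (n + 3)))
            has_real_derivative
            (1 / y ^ 3 - (\<Sum>n<N. recip_diff (n + 2) y / real (n + 3)))) (at y)"
      by (intro DERIV_diff has_real_derivative2_recip DERIV_sum DERIV_cdivide
            has_real_derivative2_bdiff_xlnx) (use y in auto)
    show "0 \<le> 1 / y ^ 3 - (\<Sum>n<N. recip_diff (n + 2) y / real (n + 3))"
      using sum_recip_diff_le[OF y, of N] by simp
  next
    have "((\<lambda>x::real. 1 / (2 * x)) \<longlongrightarrow> 0) at_top"
      by real_asymp
    moreover have "((\<lambda>x. \<Sum>n<N. bdiff (n + 2) xlnx x / real (n + 3)) \<longlongrightarrow>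
                      (\<Sum>n<N. 0 / real (n + 3))) at_top"
      by (intro tendsto_intros tendsto_bdiff_xlnx) simp_all
    ultimately show "((\<lambda>x. 1 / (2 * x) - (\<Sum>n<N. bdiff (n + 2) xlnx x / real (n + 3))) \<longlongrightarrow> 0) at_top"
      using tendsto_diff by fastforce
  qed
  thus ?thesis by simp
qed

text \<open>
  In operator form, with \<open>D\<close> the derivative and \<open>T\<close> the shift by \<open>1\<close>, this is
  \<open>- D = - ln T = (\<Sum>n. (1 - T) ^ (n + 1) / (n + 1))\<close> applied to \<open>x * ln x\<close>.
  Added to \<open>ln x + 1\<close>, the sum of the first \<open>N > 0\<close> terms tends to \<open>0\<close> at infinity and has second
  derivative \<open>- recip_diff N x / x\<close>, which on
  \<open>{u..}\<close> is at most \<open>0\<close> and at least a multiple of \<open>- 1 / x ^ 3\<close> whose factor vanishes as \<open>N\<close> grows.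
  So the function itself lies between a multiple of \<open>- 1 / x\<close> with vanishing factor and \<open>0\<close>.
\<close>

lemma sums_bdiff_xlnx_Suc:
  assumes "u > 0"
  shows   "(\<lambda>n. bdiff (Suc n) xlnx u / real (n + 1)) sums (- ln u - 1)"
proof -
  define Q where "Q = (\<lambda>N x. ln x + 1 + (\<Sum>n<N. bdiff (Suc n) xlnx x / real (n + 1)))"
  define Q' where
    "Q' = (\<lambda>N x. 1 / x + (\<Sum>n<N. bdiff (Suc n) (\<lambda>x. ln x + 1) x / real (n + 1)))"
  have Q': "(Q N has_real_derivative Q' N y) (at y)" if "y > 0" for N y
    unfolding Q_def Q'_def
    by (rule DERIV_add DERIV_sum DERIV_cdivide has_real_derivative_bdiff_xlnx that
          derivative_eq_intros refl | (use that in \<open>simp add: field_simps\<close>))+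
  have Q'': "(Q' N has_real_derivative -recip_diff N y / y) (at y)" if "y > 0" for N y
  proof -
    have "((\<lambda>x. 1 / x) has_real_derivative - 1 / y ^ 2) (at y)"
      using that by (auto intro!: derivative_eq_intros simp: field_simps power2_eq_square)
    hence "(Q' N has_real_derivative
             - 1 / y ^ 2 + (\<Sum>n<N. recip_diff (Suc n) y / real (n + 1))) (at y)"
      unfolding Q'_def
      by (intro DERIV_add DERIV_sum DERIV_cdivide has_real_derivative2_bdiff_xlnx that)
    also have "- 1 / y ^ 2 + (\<Sum>n<N. recip_diff (Suc n) y / real (n + 1)) = -recip_diff N y / y"
      using that by (subst sum_recip_diff) (simp_all add: field_simps power2_eq_square)
    finally show ?thesis .
  qed
  have lim: "(Q N \<longlongrightarrow> 0) at_top" if "N > 0" for N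
  proof -
    obtain M where N: "N = Suc M"
      using \<open>N > 0\<close> by (cases N) auto
    have "((\<lambda>x. (ln x + 1 + (x * ln x - (x + 1) * ln (x + 1))) +
             (\<Sum>n<M. bdiff (n + 2) xlnx x / real (n + 2))) \<longlongrightarrow> 0 + (\<Sum>n<M. 0 / real (n + 2))) at_top"
    proof (intro tendsto_add tendsto_sum tendsto_divide tendsto_bdiff_xlnx)
      show "((\<lambda>x::real. ln x + 1 + (x * ln x - (x + 1) * ln (x + 1))) \<longlongrightarrow> 0) at_top"
        by real_asymp
    qed auto
    also have "(\<lambda>x. (ln x + 1 + (x * ln x - (x + 1) * ln (x + 1))) +
                 (\<Sum>n<M. bdiff (n + 2) xlnx x / real (n + 2))) = Q N"
      unfolding Q_def N
      by (subst sum.lessThan_Suc_shift) (simp add: bdiff_xlnx_1[simplified] add_ac)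
    finally show ?thesis by simp
  qed
  have upper: "Q N u \<le> 0" if "N > 0" for N
  proof -
    have "0 \<le> - Q N u"
    proof (rule second_deriv_nonneg_tendsto_0_nonneg[where f = "\<lambda>y. - Q N y"])
      fix y assume "y \<ge> u"
      with assms have y: "y > 0" by simp
      show "((\<lambda>y. - Q N y) has_real_derivative - Q' N y) (at y)"
        by (intro DERIV_minus Q' y)
      show "((\<lambda>y. - Q' N y) has_real_derivative - (- recip_diff N y / y)) (at y)"
        by (intro DERIV_minus Q'' y)
      show "0 \<le> - (- recip_diff N y / y)"
        using y recip_diff_nonneg[of y N] by simp
    next
      show "((\<lambda>y. - Q N y) \<longlongrightarrow> 0) at_top"
        using tendsto_minus[OF lim[OF that]] by simp
    qed
    thus ?thesis by simp
  qed
  define K where "K = (\<lambda>N. u * (u + 1) * recip_diff N u)"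
  have lower: "- K N / (2 * u) \<le> Q N u" if "N > 0" for N
  proof -
    have "0 \<le> K N / (2 * u) + Q N u"
    proof (rule second_deriv_nonneg_tendsto_0_nonneg[where f = "\<lambda>y. K N / (2 * y) + Q N y"])
      fix y assume uy: "y \<ge> u"
      with assms have y: "y > 0" by simp
      show "((\<lambda>y. K N / (2 * y) + Q N y) has_real_derivative (- K N / (2 * y ^ 2) + Q' N y)) (at y)"
        by (intro DERIV_add Q' has_real_derivative_recip) (use y in auto)
      show "((\<lambda>y. - K N / (2 * y ^ 2) + Q' N y) has_real_derivative
              (K N / y ^ 3 + - recip_diff N y / y)) (at y)"
        by (intro DERIV_add Q'' has_real_derivative2_recip) (use y in auto)
      have "recip_diff N y \<le> K N / y ^ 2"
        unfolding K_def by (intro recip_diff_le assms uy that)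
      hence "recip_diff N y / y \<le> K N / y ^ 2 / y"
        using y by (intro divide_right_mono) auto
      thus "0 \<le> K N / y ^ 3 + - recip_diff N y / y"
        by (simp add: power2_eq_square power3_eq_cube)
    next
      have "((\<lambda>y::real. K N / (2 * y)) \<longlongrightarrow> 0) at_top"
        by real_asymp
      from tendsto_add[OF this lim[OF that]]
      show "((\<lambda>y. K N / (2 * y) + Q N y) \<longlongrightarrow> 0) at_top" by simp
    qed
    thus ?thesis by simp
  qed
  have "(\<lambda>N. - K N / (2 * u)) \<longlonglongrightarrow> - (u * (u + 1) * 0) / (2 * u)"
    unfolding K_def by (intro tendsto_intros recip_diff_tendsto_0 assms) (use assms in auto)
  hence *: "(\<lambda>N. - K N / (2 * u)) \<longlonglongrightarrow> 0" by simp
  have "(\<lambda>N. Q N u) \<longlonglongrightarrow> 0"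
  proof (rule tendsto_sandwich[OF _ _ * tendsto_const])
    show "eventually (\<lambda>N. - K N / (2 * u) \<le> Q N u) sequentially"
      using eventually_gt_at_top[of 0] by eventually_elim (rule lower)
    show "eventually (\<lambda>N. Q N u \<le> 0) sequentially"
      using eventually_gt_at_top[of 0] by eventually_elim (rule upper)
  qed
  hence "(\<lambda>N. Q N u - (ln u + 1)) \<longlonglongrightarrow> 0 - (ln u + 1)"
    by (intro tendsto_intros)
  thus ?thesis
    by (simp add: Q_def sums_def)
qed

section \<open>The series and the Gamma function\<close>

text \<open>
  The series of the theorem; in operator form, with \<open>D\<close> and \<open>T\<close> as above, it is
  \<open>D / (T - 1)\<close> applied to \<open>x * ln x\<close>.
\<close>

definition bdiff_series :: "real \<Rightarrow> real" where
  "bdiff_series u = (\<Sum>n. bdiff n xlnx u / real (n + 1))"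

lemma summable_bdiff_series_tail:
  assumes "u > 0"
  shows   "summable (\<lambda>n. bdiff (n + 2) xlnx u / real (n + 3))"
proof (rule summableI_nonneg_bounded)
  show "0 \<le> bdiff (n + 2) xlnx u / real (n + 3)" for n
    using bdiff_xlnx_nonneg[OF assms, of n] by simp
qed (rule sum_bdiff_xlnx_le[OF assms])

lemma summable_bdiff_series:
  assumes "u > 0"
  shows   "summable (\<lambda>n. bdiff n xlnx u / real (n + 1))"
proof -
  have "summable (\<lambda>n. bdiff (n + 2) xlnx u / real (n + 2 + 1))"
    using summable_bdiff_series_tail[OF assms] by (simp add: add_ac)
  thus ?thesis
    by (rule summable_iff_shift[THEN iffD1])
qed

lemma bdiff_series_plus1:
  assumes "u > 0"
  shows   "bdiff_series (u + 1) = bdiff_series u + ln u + 1"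
proof -
  have "(\<lambda>n. bdiff n xlnx u / real (n + 1) - bdiff n xlnx (u + 1) / real (n + 1)) sums
          (bdiff_series u - bdiff_series (u + 1))"
    unfolding bdiff_series_def
    by (intro sums_diff summable_sums summable_bdiff_series) (use assms in auto)
  hence "(\<lambda>n. bdiff (Suc n) xlnx u / real (n + 1)) sums (bdiff_series u - bdiff_series (u + 1))"
    by (simp add: bdiff_Suc diff_divide_distrib)
  with sums_bdiff_xlnx_Suc[OF assms] have "bdiff_series u - bdiff_series (u + 1) = - ln u - 1"
    by (rule sums_unique2[symmetric])
  thus ?thesis by simp
qed

lemma convex_on_bdiff_series: "convex_on {0<..} bdiff_series"
proof (rule convex_on_LIMSEQ)
  show "convex_on {0<..} (\<lambda>x. \<Sum>n<N. bdiff n xlnx x / real (n + 1))" for N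
  proof (induction N)
    case (Suc N)
    thus ?case
      by (auto intro!: convex_on_add convex_on_cdiv convex_on_bdiff_xlnx)
  qed (simp add: convex_on_const)
  show "(\<lambda>N. \<Sum>n<N. bdiff n xlnx x / real (n + 1)) \<longlonglongrightarrow> bdiff_series x" if "x \<in> {0<..}" for x
    unfolding bdiff_series_def using that by (intro summable_LIMSEQ summable_bdiff_series) auto
qed

lemma bdiff_series_asymptotics:
  "((\<lambda>u. bdiff_series u - (u * ln u + (u * ln u - (u + 1) * ln (u + 1)) / 2)) \<longlongrightarrow> 0) at_top"
proof -
  define R where "R = (\<lambda>u. \<Sum>n. bdiff (n + 2) xlnx u / real (n + 3))"
  have lim: "((\<lambda>u::real. 1 / (2 * u)) \<longlongrightarrow> 0) at_top"
    by real_asymp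
  have "(R \<longlongrightarrow> 0) at_top"
  proof (rule tendsto_sandwich[OF _ _ tendsto_const lim])
    show "eventually (\<lambda>u. 0 \<le> R u) at_top"
      using eventually_gt_at_top[of 0]
    proof eventually_elim
      case (elim u)
      thus ?case
        unfolding R_def using bdiff_xlnx_nonneg[of u]
        by (intro suminf_nonneg summable_bdiff_series_tail) auto
    qed
    show "eventually (\<lambda>u. R u \<le> 1 / (2 * u)) at_top"
      using eventually_gt_at_top[of 0]
      unfolding R_def
      by eventually_elim (intro suminf_le_const summable_bdiff_series_tail sum_bdiff_xlnx_le)
  qed
  moreover have "eventually (\<lambda>u. R u =
      bdiff_series u - (u * ln u + (u * ln u - (u + 1) * ln (u + 1)) / 2)) at_top"
    using eventually_gt_at_top[of 0]
  proof eventually_elim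
    case (elim u)
    have "bdiff_series u = (\<Sum>n. bdiff (n + 2) xlnx u / real (n + 2 + 1)) +
            (\<Sum>n<2. bdiff n xlnx u / real (n + 1))"
      unfolding bdiff_series_def by (rule suminf_split_initial_segment[OF summable_bdiff_series[OF elim]])
    also have "(\<Sum>n<2. bdiff n xlnx u / real (n + 1)) =
                 u * ln u + (u * ln u - (u + 1) * ln (u + 1)) / 2"
      using bdiff_xlnx_1[of u] by (simp add: numeral_2_eq_2 xlnx_def)
    finally show ?case by (simp add: R_def add_ac)
  qed
  ultimately show ?thesis
    using tendsto_cong by force
qed

lemma ln_Gamma_eq_bdiff_series_plus_const:
  "\<exists>c. \<forall>u>0. ln (Gamma u) = bdiff_series u - u + c"
proof -
  define c where "c = 1 - bdiff_series 1"
  define G where "G = (\<lambda>u. exp (bdiff_series u - u + c))"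
  have "G u = Gamma u" if "u > 0" for u
  proof (rule Gamma_pos_real_unique)
    show "G 1 = 1"
      by (simp add: G_def c_def)
    show "G (x + 1) = x * G x" if "x > 0" for x
    proof -
      have "G (x + 1) = exp (ln x + (bdiff_series x - x + c))"
        unfolding G_def by (subst bdiff_series_plus1[OF that]) (simp add: algebra_simps)
      also have "\<dots> = x * G x"
        unfolding exp_add G_def using that by simp
      finally show ?thesis .
    qed
    show "convex_on {0<..} (ln \<circ> G)"
    proof -
      have "convex_on {0<..} (\<lambda>u. bdiff_series u + (c - u))"
        by (intro convex_on_add convex_on_bdiff_series
              f''_ge0_imp_convex[where f' = "\<lambda>_. -1" and f'' = "\<lambda>_. 0"])
           (auto intro!: derivative_eq_intros)
      thus ?thesis by (simp add: G_def o_def algebra_simps)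
    qed
  qed (use that in \<open>auto simp: G_def\<close>)
  hence "ln (Gamma u) = bdiff_series u - u + c" if "u > 0" for u
    using that by (metis G_def ln_exp)
  thus ?thesis by blast
qed

lemma ln_Gamma_duplication:
  fixes u :: real
  assumes "u > 0"
  shows   "ln (Gamma u) + ln (Gamma (u + 1 / 2)) = (1 - 2 * u) * ln 2 + ln pi / 2 + ln (Gamma (2 * u))"
proof -
  have notin: "complex_of_real x \<notin> \<int>\<^sub>\<le>\<^sub>0" if "x > 0" for x
    using that by (auto elim!: nonpos_Ints_cases simp: complex_eq_iff)
  have "complex_of_real (Gamma u * Gamma (u + 1 / 2)) =
          complex_of_real (exp ((1 - 2 * u) * ln 2) * sqrt pi * Gamma (2 * u))"
    using Gamma_legendre_duplication[of "of_real u"] notin[of u] notin[of "u + 1 / 2"] assms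
    by (simp add: Gamma_complex_of_real [symmetric] exp_of_real [symmetric])
  hence "Gamma u * Gamma (u + 1 / 2) = exp ((1 - 2 * u) * ln 2) * sqrt pi * Gamma (2 * u)"
    by (simp only: of_real_eq_iff)
  hence "ln (Gamma u * Gamma (u + 1 / 2)) = ln (exp ((1 - 2 * u) * ln 2) * sqrt pi * Gamma (2 * u))"
    by simp
  thus ?thesis
    using assms by (simp add: ln_mult ln_sqrt Gamma_real_pos less_imp_neq[symmetric])
qed

lemma ln_Gamma_eq_bdiff_series:
  assumes "u > 0"
  shows   "ln (Gamma u) = bdiff_series u + 1 / 2 - u + 1 / 2 * ln (2 * pi)"
proof -
  obtain c where c: "\<And>u. u > 0 \<Longrightarrow> ln (Gamma u) = bdiff_series u - u + c"
    using ln_Gamma_eq_bdiff_series_plus_const by blast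
  define A where "A = (\<lambda>u::real. u * ln u + (u * ln u - (u + 1) * ln (u + 1)) / 2)"
  have A: "((\<lambda>u. bdiff_series u - A u) \<longlongrightarrow> 0) at_top"
    unfolding A_def by (rule bdiff_series_asymptotics)
  have "filterlim (\<lambda>u::real. 2 * u) at_top at_top" "filterlim (\<lambda>u::real. u + 1 / 2) at_top at_top"
    by real_asymp+
  note A2 = this[THEN filterlim_compose[OF A]]
  have "((\<lambda>u::real. (1 - 2 * u) * ln 2 + ln pi / 2 + 1 / 2 + (A (2 * u) - A u - A (u + 1 / 2)))
          \<longlongrightarrow> (1 + ln pi + ln 2) / 2) at_top"
    unfolding A_def by (real_asymp simp: field_simps)
  from tendsto_add[OF this tendsto_diff[OF tendsto_diff[OF A2(1) A] A2(2)]]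
  have "((\<lambda>u. (1 - 2 * u) * ln 2 + ln pi / 2 + 1 / 2 +
           (bdiff_series (2 * u) - bdiff_series u - bdiff_series (u + 1 / 2)))
          \<longlongrightarrow> (1 + ln pi + ln 2) / 2) at_top"
    by (simp add: algebra_simps)
  \<comment> \<open>By the duplication formula this function is equal to \<open>c\<close> for all \<open>u > 0\<close>.\<close>
  moreover have "eventually (\<lambda>u. (1 - 2 * u) * ln 2 + ln pi / 2 + 1 / 2 +
           (bdiff_series (2 * u) - bdiff_series u - bdiff_series (u + 1 / 2)) = c) at_top"
    using eventually_gt_at_top[of 0]
  proof eventually_elim
    case (elim u)
    thus ?case
      using ln_Gamma_duplication[OF elim] c[of u] c[of "2 * u"] c[of "u + 1 / 2"] by simp
  qed
  ultimately have "((\<lambda>_::real. c) \<longlongrightarrow> (1 + ln pi + ln 2) / 2) at_top"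
    using tendsto_cong by force
  hence "c = (1 + ln pi + ln 2) / 2"
    by (simp add: tendsto_const_iff)
  thus ?thesis
    using c[OF assms] by (simp add: ln_mult field_simps)
qed

theorem mainTheorem2:
  fixes u :: real
  assumes "u > 0"
  shows "summable (\<lambda>n::nat. 1 / real (n + 1) *
           (\<Sum>k=0..n. real (n choose k) * (-1) ^ k * (u + real k) * ln (u + real k)))
         \<and> ln (Gamma u) =
           (\<Sum>n::nat. 1 / real (n + 1) *
             (\<Sum>k=0..n. real (n choose k) * (-1) ^ k * (u + real k) * ln (u + real k)))
           + 1 / 2 - u + 1 / 2 * ln (2 * pi)"
proof -
  have "1 / real (n + 1) *
          (\<Sum>k=0..n. real (n choose k) * (-1) ^ k * (u + real k) * ln (u + real k)) =
        bdiff n xlnx u / real (n + 1)" for n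
    by (simp add: bdiff_def xlnx_def mult.assoc)
  thus ?thesis
    using summable_bdiff_series[OF assms] ln_Gamma_eq_bdiff_series[OF assms]
    by (simp only: bdiff_series_def)
qed

end
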